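(* Let $\mathrm r=(r_1,\dots,r_d)\in\mathbb{Z}_+^d$ with $\mathrm r>0$. Then the map $\Phi:\mathcal F_d^{\mathrm r}\to S_d^{\mathrm r}\times C_d^{\mathrm r}$, $(\mathbf f,c_{\mathbf f})\mapsto(\Psi((\mathbf f,c_{\mathbf f})),\mathrm c_{(\mathbf f,c_{\mathbf f})})$, is a bijection.
   Context: $d\ge2$, $[d]=\{1,\dots,d\}$. A plane forest is a finite or infinite sequence $\mathbf t_1,\mathbf t_2,\dots$ of finite rooted plane (ordered) trees; its vertices are listed in breadth-first search order (first the vertices of $\mathbf t_1$ generation by generation, each generation from left to right, then those of $\mathbf t_2$, etc.). A $d$-type forest $(\mathbf f,c_{\mathbf f})$ is a plane forest with a map $c_{\mathbf f}$ from its vertices to $[d]$ (the type) such that children of a common parent appear, from left to right, in nondecreasing order of type; $\mathcal F_d$ is the set of (unlabeled) $d$-type forests. $p_j(u)$ is the number of children of type $j$ of vertex $u$. A subtree of type $i$ is a maximal connected subgraph all of whose vertices have type $i$; the subforest $\mathbf f^{(i)}$ of type $i$ is the plane forest formed by the subtrees of type $i$ ranked according to the order of their roots in $\mathbf f$; $u^{(i)}_1,u^{(i)}_2,\dots$ are its vertices in its own breadth-first order. The root type sequence is $\mathrm c_{(\mathbf f,c_{\mathbf f})}=(c_{\mathbf f}(r(\mathbf t_1)),c_{\mathbf f}(r(\mathbf t_2)),\dots)$, $r(\mathbf t)$ the root of $\mathbf t$. $S_d$: families $x=(x^{(1)},\dots,x^{(d)})$, $x^{(i)}=(x^{i,1},\dots,x^{i,d})$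 a $\mathbb{Z}^d$-valued sequence indexed by $\{0,\dots,n_i\}$ ($0\le n_i\le\infty$), $x^{(i)}_0=0$, $x^{i,j}$ nondecreasing for $i\ne j$, $x^{i,i}_{n+1}-x^{i,i}_n\ge -1$; $(n_1,\dots,n_d)$ is its length; $x^{i,j}(n):=x^{i,j}_n$. $\Psi:\mathcal F_d\to S_d$ maps $(\mathbf f,c_{\mathbf f})$ to $x$ where $n_i$ is the number of vertices of $\mathbf f^{(i)}$, $x^{(i)}_0=0$, $x^{i,j}_{n+1}-x^{i,j}_n=p_j(u^{(i)}_{n+1})$ for $j\ne i$ and $x^{i,i}_{n+1}-x^{i,i}_n=p_i(u^{(i)}_{n+1})-1$, $0\le n\le n_i-1$. Coordinatewise order $\le$; $\mathrm q<\mathrm q'$ means $\mathrm q\le\mathrm q'$ and $\mathrm q\ne\mathrm q'$. A solution of $(\mathrm r,x)$ (for $x$ of length $\mathrm q$) is $\mathrm s\in\mathbb{Z}_+^d$, $\mathrm s\le\mathrm q$, with $r_j+\sum_ix^{i,j}(s_i)=0$ for all $j$; the smallest solution is a solution $\le$ every solution. $S_d^{\mathrm r}$ is the set of $x\in S_d$ whose length lies in $\mathbb{N}^d$ ($\mathbb N=\{1,2,\dots\}$) and is the smallest solution of $(\mathrm r,x)$. For $r=r_1+\dots+r_d$, $C_d^{\mathrm r}=\{c\in[d]^r:\#\{j\in[r]:c_j=i\}=r_i,\ i\in[d]\}$. $\mathcal F_d^{\mathrm r}$ is the set of $(\mathbf f,c_{\mathbf f})\in\mathcal F_d$ having $r_1+\dots+r_d$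 trees, containing at least one vertex of each type, and with root type sequence in $C_d^{\mathrm r}$. *)

theory Defs
  imports Main
begin

text \<open>A finite rooted plane tree whose vertices carry a label; the children of a
vertex are given as a list, from left to right. Unlabeled plane trees are exactly
these rose trees (up to labels), so no quotient is needed.\<close>

datatype 'a rtree = RNode (label: 'a) (kids: "'a rtree list")

fun height :: "'a rtree \<Rightarrow> nat" where
  "height (RNode a cs) = Suc (foldr max (map height cs) 0)"

text \<open>Vertices (as subtrees rooted at them) of generation k, from left to right.\<close>
fun gen :: "'a rtree \<Rightarrow> nat \<Rightarrow> 'a rtree list" where
  "gen t 0 = [t]"
| "gen (RNode a cs) (Suc k) = concat (map (\<lambda>c. gen c k) cs)"

definition bfs_tree :: "'a rtree \<Rightarrow> 'a rtree list" where
  "bfs_tree t = concat (map (gen t) [0..<height t])"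

definition bfs_forest :: "'a rtree list \<Rightarrow> 'a rtree list" where
  "bfs_forest ts = concat (map bfs_tree ts)"

definition dtype_forest :: "nat \<Rightarrow> nat rtree list \<Rightarrow> bool" where
  "dtype_forest d f \<longleftrightarrow>
     (\<forall>v\<in>set (bfs_forest f). label v \<in> {1..d} \<and> sorted (map label (kids v)))"

definition nchild :: "nat \<Rightarrow> nat rtree \<Rightarrow> nat" where
  "nchild j u = length (filter (\<lambda>c. label c = j) (kids u))"

fun ann :: "'a option \<Rightarrow> 'a rtree \<Rightarrow> ('a option \<times> 'a rtree) rtree" where
  "ann p (RNode a cs) = RNode (p, RNode a cs) (map (ann (Some a)) cs)"

text \<open>The maximal subtree of type i rooted at a vertex v of type i: its vertices are
(the vertices of f, represented by) the subtrees of f rooted at them, and the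
children of a vertex are its children of type i, in the same left-to-right order.\<close>
fun msub :: "'a \<Rightarrow> 'a rtree \<Rightarrow> 'a rtree rtree" where
  "msub i (RNode a cs) =
     RNode (RNode a cs) (concat (map (\<lambda>c. if label c = i then [msub i c] else []) cs))"

text \<open>The subforest of type i: the subtrees of type i ranked according to the order
of their roots in f (breadth-first order of f). A vertex is the root of a subtree of
type i iff it has type i and it is a root of f or its parent is not of type i.\<close>
definition subforest :: "nat \<Rightarrow> nat rtree list \<Rightarrow> nat rtree rtree list" where
  "subforest i f =
     map (\<lambda>(p, v). msub i v)
       (filter (\<lambda>(p, v). label v = i \<and> p \<noteq> Some i)
          (map label (bfs_forest (map (ann None) f))))"

text \<open>u^(i)_1, u^(i)_2, ...: the vertices of the subforest of type i in its own
breadth-first order (each given as the vertex of f it is, i.e. the subtree of f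
rooted at it). So u^(i)_(n+1) = sub_verts i f ! n.\<close>
definition sub_verts :: "nat \<Rightarrow> nat rtree list \<Rightarrow> nat rtree list" where
  "sub_verts i f = map label (bfs_forest (subforest i f))"

text \<open>An element x = (x^(1),...,x^(d)) with finite lengths is represented as a list
of d lists; x ! (i-1) is the sequence x^(i)_0, ..., x^(i)_(n_i) (length n_i+1), and
each x^(i)_n is a list of length d with x ! (i-1) ! n ! (j-1) = x^(i,j)_n.\<close>

definition xc :: "int list list list \<Rightarrow> nat \<Rightarrow> nat \<Rightarrow> nat \<Rightarrow> int" where
  "xc x i j n = x ! (i - 1) ! n ! (j - 1)"

definition xlen :: "int list list list \<Rightarrow> nat \<Rightarrow> nat" where
  "xlen x i = length (x ! (i - 1)) - 1"

definition in_Sd :: "nat \<Rightarrow> int list list list \<Rightarrow> bool" where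
  "in_Sd d x \<longleftrightarrow> length x = d \<and>
     (\<forall>i\<in>{1..d}. x ! (i - 1) \<noteq> [] \<and>
        (\<forall>n\<le>xlen x i. length (x ! (i - 1) ! n) = d) \<and>
        (\<forall>j\<in>{1..d}. xc x i j 0 = 0) \<and>
        (\<forall>j\<in>{1..d}. j \<noteq> i \<longrightarrow> (\<forall>n<xlen x i. xc x i j n \<le> xc x i j (Suc n))) \<and>
        (\<forall>n<xlen x i. xc x i i (Suc n) - xc x i i n \<ge> -1))"

text \<open>s is a solution of (r, x): s \<le> length of x and r_j + sum_i x^(i,j)(s_i) = 0.
Vectors of Z_+^d are functions nat => nat, only their values on {1..d} matter.\<close>
definition is_solution :: "nat \<Rightarrow> (nat \<Rightarrow> nat) \<Rightarrow> int list list list \<Rightarrow> (nat \<Rightarrow> nat) \<Rightarrow> bool" where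
  "is_solution d r x s \<longleftrightarrow>
     (\<forall>i\<in>{1..d}. s i \<le> xlen x i) \<and>
     (\<forall>j\<in>{1..d}. int (r j) + (\<Sum>i=1..d. xc x i j (s i)) = 0)"

definition smallest_solution :: "nat \<Rightarrow> (nat \<Rightarrow> nat) \<Rightarrow> int list list list \<Rightarrow> (nat \<Rightarrow> nat) \<Rightarrow> bool" where
  "smallest_solution d r x s \<longleftrightarrow> is_solution d r x s \<and>
     (\<forall>s'. is_solution d r x s' \<longrightarrow> (\<forall>i\<in>{1..d}. s i \<le> s' i))"

definition Sdr :: "nat \<Rightarrow> (nat \<Rightarrow> nat) \<Rightarrow> int list list list set" where
  "Sdr d r = {x. in_Sd d x \<and> (\<forall>i\<in>{1..d}. xlen x i \<ge> 1) \<and>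
                 smallest_solution d r x (xlen x)}"

definition Cdr :: "nat \<Rightarrow> (nat \<Rightarrow> nat) \<Rightarrow> nat list set" where
  "Cdr d r = {c. length c = (\<Sum>i=1..d. r i) \<and> set c \<subseteq> {1..d} \<and>
                 (\<forall>i\<in>{1..d}. count_list c i = r i)}"

definition Psi :: "nat \<Rightarrow> nat rtree list \<Rightarrow> int list list list" where
  "Psi d f = map (\<lambda>i. let us = sub_verts i f in
       map (\<lambda>n. map (\<lambda>j. \<Sum>m<n. int (nchild j (us ! m)) - (if i = j then 1 else 0)) [1..<Suc d])
           [0..<Suc (length us)])
     [1..<Suc d]"

definition root_types :: "nat rtree list \<Rightarrow> nat list" where
  "root_types f = map label f"

definition Phi :: "nat \<Rightarrow> nat rtree list \<Rightarrow> int list list list \<times> nat list" where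
  "Phi d f = (Psi d f, root_types f)"

text \<open>F_d^r: d-type forests with r_1+...+r_d trees, at least one vertex of each type,
and root type sequence in C_d^r. Such forests are finite, hence lists of trees.\<close>
definition Fdr :: "nat \<Rightarrow> (nat \<Rightarrow> nat) \<Rightarrow> nat rtree list set" where
  "Fdr d r = {f. dtype_forest d f \<and> length f = (\<Sum>i=1..d. r i) \<and>
                 (\<forall>i\<in>{1..d}. \<exists>v\<in>set (bfs_forest f). label v = i) \<and>
                 root_types f \<in> Cdr d r}"

end

theory Submission
  imports Defs "HOL-Library.Multiset" "HOL-Library.Sublist"
begin

text \<open>
  Label every vertex of a subtree of type \<open>i\<close> by the sorted word of the types of all its children in
  the forest; call the result a skeleton. Reading the skeletons of type \<open>i\<close> breadth-first gives a list of
  words \<open>code i f\<close>, and \<open>Psi\<close> just records the partial sums of letter counts of these words.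

  A forest can be rebuilt from its root types and, for each type, the queue of its skeletons: go
  through the vertices in breadth-first order and take a child of its parent's type from the parent's
  skeleton, and any other child from the head of the queue of its type. This procedure is
  deterministic, whence uniqueness, even when the queues are only known up to unused suffixes. If each
  queue is at least as long as the total demand for its type, the procedure never runs dry, whence
  existence. A solution \<open>s\<close> of \<open>(r, x)\<close> says precisely that the words up to \<open>s\<close> have supply equal to
  demand. So every solution yields a forest whose code is a prefix of the words, and the code of any
  forest is itself a solution. Hence the smallest solution is consumed completely, which gives
  surjectivity; and applied to a solution below the length of \<open>Psi d f\<close>, the procedure must return \<open>f\<close>
  itself by uniqueness, so that this length is the smallest solution.
\<close>

section \<open>Breadth-first order and subtrees of one type\<close>

text \<open>All trees of the list are traversed jointly, whereas \<open>bfs_forest\<close> finishes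
  one tree before the next. Recursion on whole generations suits inductions in which each generation
  determines the next.\<close>

function lev :: "'a rtree list \<Rightarrow> 'a rtree list" where
  "lev ts = (if ts = [] then [] else ts @ lev (concat (map kids ts)))"
  by pat_completeness auto
termination
proof (relation "measure (\<lambda>ts. sum_list (map size ts))")
  fix ts :: "'a rtree list"
  have *: "sum_list (map size (kids t)) < size t" for t :: "'a rtree"
    by (cases t) (simp add: size_list_conv_sum_list less_Suc_eq_le sum_list_mono)
  have "sum_list (map size (concat (map kids ts))) + length ts \<le> sum_list (map size ts)"
  proof (induction ts)
    case (Cons t ts)
    then show ?case using *[of t] by simp
  qed simp
  moreover assume "ts \<noteq> []"
  ultimately show "(concat (map kids ts), ts) \<in> measure (\<lambda>ts. sum_list (map size ts))"
    by (cases ts) auto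
qed simp

declare lev.simps [simp del]

lemma lev_Nil [simp]: "lev [] = []"
  by (subst lev.simps) simp

lemma lev_nonempty: "ts \<noteq> [] \<Longrightarrow> lev ts = ts @ lev (concat (map kids ts))"
  by (subst lev.simps) simp

lemma height_neq_0 [simp]: "height t \<noteq> 0"
  by (cases t) simp

lemma height_kids: "t' \<in> set (kids t) \<Longrightarrow> height t' < height t"
proof (cases t)
  case (RNode a cs)
  have "t' \<in> set cs \<Longrightarrow> height t' \<le> foldr max (map height cs) 0"
    by (induction cs) auto
  then show "t' \<in> set (kids t) \<Longrightarrow> height t' < height t" using RNode by auto
qed

lemma gen_Suc: "gen t (Suc k) = concat (map (\<lambda>c. gen c k) (kids t))"
  by (cases t) simp

lemma concat_map_concat_map:
  "concat (map g (concat (map h xs))) = concat (map (\<lambda>x. concat (map g (h x))) xs)"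
  by (induction xs) auto

text \<open>Generations beyond the height of a tree are empty, so any common bound \<open>h\<close>
  serves; this slack lets the induction pass to the list of all children with the bound lowered by
  one.\<close>

lemma lev_conv_gen:
  assumes "\<forall>t\<in>set ts. height t \<le> h"
  shows "lev ts = concat (map (\<lambda>k. concat (map (\<lambda>t. gen t k) ts)) [0..<h])"
  using assms
proof (induction h arbitrary: ts)
  case 0
  have "ts = []" using 0 by (cases ts) auto
  then show ?case by simp
next
  case (Suc h)
  show ?case
  proof (cases "ts = []")
    case False
    have "\<forall>t\<in>set (concat (map kids ts)). height t \<le> h"
      using Suc.prems height_kids by fastforce
    from Suc.IH[OF this]
    have "lev (concat (map kids ts)) = concat (map (\<lambda>k. concat (map (\<lambda>t. gen t (Suc k)) ts)) [0..<h])"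
      by (simp add: gen_Suc concat_map_concat_map)
    moreover have "concat (map (\<lambda>t. gen t 0) ts) = ts" by (induction ts) auto
    ultimately show ?thesis
      by (simp add: lev_nonempty[OF False] upt_conv_Cons map_Suc_upt[symmetric] comp_def del: upt_Suc)
  qed (simp add: concat_eq_Nil_conv)
qed


lemma bfs_tree_conv_lev: "bfs_tree t = lev [t]"
  using lev_conv_gen[of "[t]" "height t"] by (simp add: bfs_tree_def)

lemma bfs_forest_Nil [simp]: "bfs_forest [] = []"
  by (simp add: bfs_forest_def)

lemma bfs_forest_Cons [simp]: "bfs_forest (t # ts) = lev [t] @ bfs_forest ts"
  by (simp add: bfs_forest_def bfs_tree_conv_lev)

lemma bfs_forest_append [simp]: "bfs_forest (ts @ ts') = bfs_forest ts @ bfs_forest ts'"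
  by (simp add: bfs_forest_def)

lemma kids_map_rtree: "kids (map_rtree g t) = map (map_rtree g) (kids t)"
  by (cases t) simp

lemma label_map_rtree: "label (map_rtree g t) = g (label t)"
  by (cases t) simp

lemma lev_map_rtree: "lev (map (map_rtree g) ts) = map (map_rtree g) (lev ts)"
proof (induction ts rule: lev.induct)
  case (1 ts)
  show ?case
  proof (cases "ts = []")
    case False
    have "concat (map kids (map (map_rtree g) ts)) = map (map_rtree g) (concat (map kids ts))"
      by (simp add: map_concat comp_def kids_map_rtree)
    then show ?thesis using 1[OF False] False
      by (simp add: lev_nonempty)
  qed simp
qed

lemma map_label_bfs_forest_map_rtree:
  "map label (bfs_forest (map (map_rtree g) ts)) = map (g \<circ> label) (bfs_forest ts)"
  using lev_map_rtree[of g "[_]"]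
  by (induction ts) (simp_all add: label_map_rtree comp_def)

section \<open>Roots of the subtrees of one type\<close>

lemma label_ann: "label (ann p t) = (p, t)"
  by (cases t) simp

lemma kids_ann: "kids (ann p t) = map (ann (Some (label t))) (kids t)"
  by (cases t) simp

text \<open>Breadth-first order lists the later generations grouped by parent, the parents
  themselves being in breadth-first order, so each annotation can be read off from the
  parent.\<close>

lemma map_label_lev_ann:
  "map label (lev (map (\<lambda>(p, t). ann p t) ps)) =
     ps @ concat (map (\<lambda>v. map (Pair (Some (label v))) (kids v)) (lev (map snd ps)))"
proof (induction "map snd ps" arbitrary: ps rule: lev.induct)
  case 1
  show ?case
  proof (cases "ps = []")
    case False
    define ps' where "ps' = concat (map (\<lambda>v. map (Pair (Some (label v))) (kids v)) (map snd ps))"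
    have snd: "map snd ps' = concat (map kids (map snd ps))"
      by (simp add: ps'_def map_concat comp_def)
    have ann: "concat (map kids (map (\<lambda>(p, t). ann p t) ps)) = map (\<lambda>(p, t). ann p t) ps'"
      by (simp add: ps'_def map_concat comp_def kids_ann split_beta)
    have "map label (map (\<lambda>(p, t). ann p t) ps) = ps"
      by (simp add: comp_def label_ann split_beta)
    moreover have "lev (map (\<lambda>(p, t). ann p t) ps) = map (\<lambda>(p, t). ann p t) ps @ lev (map (\<lambda>(p, t). ann p t) ps')"
      using False by (subst lev_nonempty) (simp_all add: ann del: map_map)
    moreover have "lev (map snd ps) = map snd ps @ lev (map snd ps')"
      using False by (subst lev_nonempty) (simp_all add: snd del: map_map)
    moreover have "map label (lev (map (\<lambda>(p, t). ann p t) ps')) =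
       ps' @ concat (map (\<lambda>v. map (Pair (Some (label v))) (kids v)) (lev (map snd ps')))"
      using 1[OF _ snd[symmetric]] False by simp
    ultimately show ?thesis by (simp add: ps'_def)
  qed simp
qed

text \<open>Applied to all vertices of a forest, this gives the roots of its subtrees of type \<open>j\<close> other than
the roots of the forest.\<close>

definition entering :: "nat \<Rightarrow> nat rtree list \<Rightarrow> nat rtree list" where
  "entering j ts = concat (map (\<lambda>t. if label t = j then [] else filter (\<lambda>c. label c = j) (kids t)) ts)"

lemma entering_Nil [simp]: "entering j [] = []"
  by (simp add: entering_def)

lemma entering_Cons [simp]:
  "entering j (t # ts) = (if label t = j then [] else filter (\<lambda>c. label c = j) (kids t)) @ entering j ts"
  by (simp add: entering_def)

lemma entering_append [simp]: "entering j (ts @ ts') = entering j ts @ entering j ts'"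
  by (simp add: entering_def)

text \<open>Scanning parents in breadth-first order meets their children in breadth-first order too,
  so the roots appear in the order that ranks the subtrees, without an annotated copy of the
  forest.\<close>

definition sub_roots :: "nat \<Rightarrow> nat rtree list \<Rightarrow> nat rtree list" where
  "sub_roots j f = concat (map (\<lambda>t. filter (\<lambda>t. label t = j) [t] @ entering j (lev [t])) f)"

lemma sub_roots_Nil [simp]: "sub_roots j [] = []"
  by (simp add: sub_roots_def)

lemma sub_roots_Cons [simp]:
  "sub_roots j (t # f) = (if label t = j then [t] else []) @ entering j (lev [t]) @ sub_roots j f"
  by (simp add: sub_roots_def)

lemma label_sub_roots: "v \<in> set (sub_roots j f) \<Longrightarrow> label v = j"
  by (induction f) (auto simp: entering_def split: if_splits)

lemma subforest_conv_sub_roots: "subforest j f = map (msub j) (sub_roots j f)"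
proof -
  have ent: "map snd (filter (\<lambda>(p, v). label v = j \<and> p \<noteq> Some j)
     (concat (map (\<lambda>v. map (Pair (Some (label v))) (kids v)) ts))) = entering j ts" for ts
  proof (induction ts)
    case (Cons t ts)
    have "map snd (filter (\<lambda>(p, v). label v = j \<and> p \<noteq> Some j) (map (Pair (Some (label t))) cs)) =
      (if label t = j then [] else filter (\<lambda>c. label c = j) cs)" for cs
      by (induction cs) auto
    then show ?case using Cons by simp
  qed simp
  have "map snd (filter (\<lambda>(p, v). label v = j \<and> p \<noteq> Some j)
          (map label (bfs_forest (map (ann None) f)))) = sub_roots j f"
  proof (induction f)
    case (Cons t f)
    show ?case using map_label_lev_ann[of "[(None, t)]"] Cons.IH by (simp add: ent)
  qed simp
  moreover have "map (\<lambda>(p, v). msub j v) ps = map (msub j) (map snd ps)" for ps :: "(nat option \<times> nat rtree) list"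
    by (simp add: split_beta)
  ultimately show ?thesis
    by (simp only: subforest_def)
qed

text \<open>Only children of the vertex's own type are followed; the others survive as letters of
  the word. The type is not stored, so skeletons travel with it, in pairs or in queues indexed by
  type.\<close>

fun skel :: "nat rtree \<Rightarrow> nat list rtree" where
  "skel (RNode a cs) = RNode (map label cs) (map skel (filter (\<lambda>c. label c = a) cs))"

lemma label_skel: "label (skel t) = map label (kids t)"
  by (cases t) simp

lemma kids_skel: "kids (skel t) = map skel (filter (\<lambda>c. label c = label t) (kids t))"
  by (cases t) simp

lemma map_rtree_msub: "label v = i \<Longrightarrow> map_rtree (\<lambda>v. map label (kids v)) (msub i v) = skel v"
proof (induction v)
  case (RNode a cs)
  have "map (map_rtree (\<lambda>v. map label (kids v))) (concat (map (\<lambda>c. if label c = i then [msub i c] else []) cs')) =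
    map skel (filter (\<lambda>c. label c = i) cs')" if "set cs' \<subseteq> set cs" for cs'
    using that RNode.IH by (induction cs') auto
  then show ?case using RNode.prems by simp
qed

definition code :: "nat \<Rightarrow> nat rtree list \<Rightarrow> nat list list" where
  "code j f = map (\<lambda>v. map label (kids v)) (sub_verts j f)"

lemma code_conv_skel: "code j f = map label (bfs_forest (map skel (sub_roots j f)))"
proof -
  have "map skel (sub_roots j f) = map (map_rtree (\<lambda>v. map label (kids v))) (subforest j f)"
    by (simp add: subforest_conv_sub_roots map_rtree_msub label_sub_roots)
  then show ?thesis
    by (simp add: code_def sub_verts_def map_label_bfs_forest_map_rtree comp_def)
qed

section \<open>Uniqueness of the assembly\<close>

text \<open>The keys say from which sublist the next element comes. Below, keys are types and values
  are skeletons.\<close>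

lemma map_eq_by_filter:
  assumes "map k xs = map k ys"
    and "\<And>j. map g (filter (\<lambda>x. k x = j) xs) = map g (filter (\<lambda>y. k y = j) ys)"
  shows "map g xs = map g ys"
  using assms
proof (induction xs arbitrary: ys)
  case (Cons x xs)
  then obtain y ys' where ys: "ys = y # ys'" "k x = k y" "map k xs = map k ys'"
    by (cases ys) auto
  have "g x = g y" using Cons.prems(2)[of "k x"] ys by simp
  moreover have "map g (filter (\<lambda>x. k x = j) xs) = map g (filter (\<lambda>y. k y = j) ys')" for j
    using Cons.prems(2)[of j] ys by (simp split: if_splits)
  ultimately show ?case using Cons.IH ys by simp
qed simp

lemma length_filter_eq_if_map_eq:
  "map k xs = map k ys \<Longrightarrow> length (filter (\<lambda>x. P (k x)) xs) = length (filter (\<lambda>x. P (k x)) ys)"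
proof (induction xs arbitrary: ys)
  case (Cons x xs)
  then show ?case by (cases ys) auto
qed simp

text \<open>The words at the roots of the skeletons already count the children of each type. This
  locates the point where a queue passes on to the next generation.\<close>

lemma length_entering_eq:
  "map label ts = map label ts' \<Longrightarrow> map skel ts = map skel ts' \<Longrightarrow>
     length (entering j ts) = length (entering j ts')"
proof (induction ts arbitrary: ts')
  case (Cons t ts)
  then obtain t' ts'' where ts': "ts' = t' # ts''" by (cases ts') auto
  have "map label (kids t) = map label (kids t')"
    using Cons.prems(2) ts' label_skel by (metis list.inject list.simps(9))
  then have "length (filter (\<lambda>c. label c = j) (kids t)) = length (filter (\<lambda>c. label c = j) (kids t'))"
    by (rule length_filter_eq_if_map_eq)
  then show ?case using Cons ts' by simp
qed simp

text \<open>A child of its parent's type has its skeleton inside that of the parent, any other child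
  is listed by \<open>entering\<close>; the root words say how to interleave the two.\<close>

lemma map_skel_kids_eq:
  assumes "map label ts = map label ts'" "map skel ts = map skel ts'"
    and "\<And>j. map skel (entering j ts) = map skel (entering j ts')"
  shows "map skel (concat (map kids ts)) = map skel (concat (map kids ts'))"
  using assms
proof (induction ts arbitrary: ts')
  case (Cons t ts)
  then obtain t' ts'' where ts': "ts' = t' # ts''" by (cases ts') auto
  have eqs: "label t = label t'" "skel t = skel t'" "map label ts = map label ts''" "map skel ts = map skel ts''"
    using Cons.prems ts' by auto
  have lab: "map label (kids t) = map label (kids t')"
    using eqs(2) label_skel by metis
  \<comment> \<open>The tails contributed by the remaining vertices have equal length, so the share
    of the first vertex can be separated.\<close>
  have split: "map skel (if label t = j then [] else filter (\<lambda>c. label c = j) (kids t)) =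
      map skel (if label t' = j then [] else filter (\<lambda>c. label c = j) (kids t')) \<and>
      map skel (entering j ts) = map skel (entering j ts'')" for j
  proof -
    have "length (entering j ts) = length (entering j ts'')"
      using length_entering_eq eqs by blast
    then show ?thesis using Cons.prems(3)[of j] ts' by (simp add: append_eq_append_conv split: if_splits)
  qed
  have "map skel (filter (\<lambda>c. label c = j) (kids t)) = map skel (filter (\<lambda>c. label c = j) (kids t'))" for j
  proof (cases "j = label t")
    case True
    then show ?thesis using eqs kids_skel by metis
  next
    case False
    then show ?thesis using split[of j] eqs by auto
  qed
  then have "map skel (kids t) = map skel (kids t')"
    by (rule map_eq_by_filter[OF lab])
  then show ?case using Cons.IH[OF eqs(3,4)] split ts' by simp
qed simp

lemma eq_if_map_kids_eq:
  assumes "map label ts = map label ts'" "map length (map kids ts) = map length (map kids ts')"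
    and "concat (map kids ts) = concat (map kids ts')"
  shows "ts = ts'"
  using assms
proof (induction ts arbitrary: ts')
  case (Cons t ts)
  then obtain t' ts'' where ts': "ts' = t' # ts''" by (cases ts') auto
  then show ?case using Cons by (auto simp: rtree.expand)
qed simp

text \<open>A generation and the queues determine the skeletons of the next generation, and the
  trees are recovered once their children are. \<open>R\<close> and \<open>R'\<close> are the parts
  of the queues left for later trees.\<close>

lemma levels_unique:
  assumes "map label ts = map label ts'" "map skel ts = map skel ts'"
    and "\<And>j. map skel (entering j (lev ts)) @ R j = map skel (entering j (lev ts')) @ R' j"
  shows "ts = ts'"
  using assms
proof (induction ts arbitrary: ts' rule: lev.induct)
  case (1 ts)
  show ?case
  proof (cases "ts = []")
    case False
    then have False': "ts' \<noteq> []" using 1 by auto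
    let ?ns = "concat (map kids ts)" and ?ns' = "concat (map kids ts')"
    have len: "length (entering j ts) = length (entering j ts')" for j
      using length_entering_eq 1 by blast
    have ent: "map skel (entering j ts) = map skel (entering j ts') \<and>
       map skel (entering j (lev ?ns)) @ R j = map skel (entering j (lev ?ns')) @ R' j" for j
      using "1.prems"(3)[of j] len[of j] by (simp add: lev_nonempty False False' append_eq_append_conv)
    have kl: "map (map label) (map kids ts) = map (map label) (map kids ts')"
      using arg_cong[OF "1.prems"(2), of "map label"] unfolding map_map comp_def label_skel .
    then have "map label ?ns = map label ?ns'"
      by (metis map_concat)
    moreover have "map skel ?ns = map skel ?ns'"
      using map_skel_kids_eq "1.prems" ent by blast
    ultimately have "?ns = ?ns'"
      using "1.IH"[OF False] ent by blast
    moreover have "map length (map kids ts) = map length (map kids ts')"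
      using arg_cong[OF kl, of "map length"] by (simp add: comp_def)
    ultimately show ?thesis using eq_if_map_kids_eq "1.prems"(1) by blast
  qed (use 1 in simp)
qed

lemma forest_unique:
  assumes "map label f = map label f'"
    and "\<And>j. map skel (sub_roots j f) @ R j = map skel (sub_roots j f') @ R' j"
  shows "f = f'"
  using assms
proof (induction f arbitrary: f')
  case (Cons t f)
  then obtain t' f'' where f': "f' = t' # f''" by (cases f') auto
  have lab: "label t = label t'" using Cons.prems f' by simp
  have "skel t = skel t'"
    using Cons.prems(2)[of "label t"] f' lab by simp
  moreover have "map skel (entering j (lev [t])) @ map skel (sub_roots j f) @ R j =
      map skel (entering j (lev [t'])) @ map skel (sub_roots j f'') @ R' j" for j
    using Cons.prems(2)[of j] f' lab by (simp split: if_splits)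
  \<comment> \<open>For the first tree, what the rest of the forest takes from the queues counts as
    leftover.\<close>
  ultimately have "[t] = [t']"
    using lab by (intro levels_unique[where R = "\<lambda>j. map skel (sub_roots j f) @ R j"
      and R' = "\<lambda>j. map skel (sub_roots j f'') @ R' j"]) auto
  then have "t = t'" by simp
  moreover have "f = f''"
    using Cons.prems \<open>t = t'\<close> f' by (intro Cons.IH) (auto split: if_splits)
  ultimately show ?case using f' by simp
qed simp

section \<open>Breadth-first coding of monochromatic forests\<close>

text \<open>Describes skeletons of type \<open>i\<close>: the letters \<open>i\<close> of a word are
  the children within the skeleton. The alphabet \<open>I\<close> is \<open>UNIV\<close> where only
  the arities matter.\<close>

fun valid :: "nat set \<Rightarrow> nat \<Rightarrow> nat list rtree \<Rightarrow> bool" where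
  "valid I i (RNode w ks) \<longleftrightarrow> set w \<subseteq> I \<and> length ks = count_list w i \<and> (\<forall>k\<in>set ks. valid I i k)"

lemma valid_kids: "valid I i t \<Longrightarrow> k \<in> set (kids t) \<Longrightarrow> valid I i k"
  by (cases t) simp

lemma length_kids_valid: "valid I i t \<Longrightarrow> length (kids t) = count_list (label t) i"
  by (cases t) simp

lemma set_label_valid: "valid I i t \<Longrightarrow> set (label t) \<subseteq> I"
  by (cases t) simp

lemma count_list_map_label: "count_list (map k xs) j = length (filter (\<lambda>x. k x = j) xs)"
  by (induction xs) auto

lemma valid_skel: "valid UNIV (label t) (skel t)"
  by (induction t) (auto simp: count_list_map_label)

text \<open>The code is self-delimiting: the number of trees fixes where the first generation ends,
  and its letters \<open>i\<close> give the size of the next one.\<close>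

lemma lev_valid_prefix_unique:
  assumes "length ts = length ts'" "\<forall>t\<in>set ts. valid I i t" "\<forall>t\<in>set ts'. valid I i t"
    and "map label (lev ts) @ R = map label (lev ts') @ R'"
  shows "ts = ts'"
  using assms
proof (induction ts arbitrary: ts' rule: lev.induct)
  case (1 ts)
  show ?case
  proof (cases "ts = []")
    case False
    then have False': "ts' \<noteq> []" using 1 by auto
    let ?ns = "concat (map kids ts)" and ?ns' = "concat (map kids ts')"
    have lab: "map label ts = map label ts'"
      and rest: "map label (lev ?ns) @ R = map label (lev ?ns') @ R'"
      using "1.prems"(1,4) by (simp_all add: lev_nonempty False False' append_eq_append_conv)
    have len: "map length (map kids us) = map (\<lambda>w. count_list w i) (map label us)"
      if "\<forall>t\<in>set us. valid I i t" for us
      using that by (auto simp: length_kids_valid)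
    have lens: "map length (map kids ts) = map length (map kids ts')"
      using len lab "1.prems"(2,3) by metis
    then have "length ?ns = length ?ns'"
      by (metis length_concat)
    moreover have "\<forall>t\<in>set ?ns. valid I i t" "\<forall>t\<in>set ?ns'. valid I i t"
      using "1.prems"(2,3) by (auto intro: valid_kids)
    ultimately have "?ns = ?ns'"
      using "1.IH"[OF False] rest by blast
    then show ?thesis using eq_if_map_kids_eq lab lens by blast
  qed (use 1 in simp)
qed

lemma forest_valid_prefix:
  assumes "\<forall>t\<in>set ts. valid I i t" "\<forall>t\<in>set ts'. valid I i t"
    and "prefix (map label (bfs_forest ts)) (map label (bfs_forest ts'))"
  shows "prefix ts ts'"
  using assms
proof (induction ts arbitrary: ts')
  case (Cons t ts)
  then obtain t' ts'' where ts': "ts' = t' # ts''"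
    by (cases ts') (auto simp: lev_nonempty)
  obtain R where R: "map label (bfs_forest (t # ts)) @ R = map label (bfs_forest ts')"
    using Cons.prems(3) by (metis prefixE)
  then have "[t] = [t']"
    using Cons.prems ts' by (intro lev_valid_prefix_unique[where R = "map label (bfs_forest ts) @ R"
       and R' = "map label (bfs_forest ts'')" and I = I and i = i]) auto
  then show ?case using Cons ts' by auto
qed simp

text \<open>Every vertex outside the first generation is counted by exactly one letter
  \<open>i\<close>, in the word of its parent.\<close>

lemma sum_list_count_lev:
  assumes "\<forall>t\<in>set ts. valid I i t"
  shows "(\<Sum>w\<leftarrow>map label (lev ts). count_list w i) + length ts = length (lev ts)"
  using assms
proof (induction ts rule: lev.induct)
  case (1 ts)
  show ?case
  proof (cases "ts = []")
    case False
    have "map length (map kids ts) = map (\<lambda>w. count_list w i) (map label ts)"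
      using "1.prems" by (auto simp: length_kids_valid)
    then have "length (concat (map kids ts)) = (\<Sum>w\<leftarrow>map label ts. count_list w i)"
      by (metis length_concat)
    moreover have "\<forall>t\<in>set (concat (map kids ts)). valid I i t"
      using "1.prems" by (auto intro: valid_kids)
    ultimately show ?thesis
      using "1.IH"[OF False] by (simp add: lev_nonempty False)
  qed simp
qed

lemma group_list:
  "sum_list ns = length xs \<Longrightarrow> \<exists>xss. concat xss = xs \<and> map length xss = ns"
proof (induction ns arbitrary: xs)
  case Nil
  then show ?case by (intro exI[of _ "[]"]) auto
next
  case (Cons n ns)
  then have "sum_list ns = length (drop n xs)" by simp
  from Cons.IH[OF this] obtain xss where "concat xss = drop n xs" "map length xss = ns" by blast
  then show ?case using Cons.prems by (intro exI[of _ "take n xs # xss"]) auto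
qed

text \<open>Lukasiewicz-type decoding: a walk with steps \<open>count_list w i - 1\<close> from
  \<open>m\<close> that ends at or below 0 must hit 0, and the words up to then code
  \<open>m\<close> trees. Cutting off the first generation makes its letters \<open>i\<close> the
  new \<open>m\<close> and keeps the inequality.\<close>

lemma lev_decode:
  assumes "m + (\<Sum>w\<leftarrow>ws. count_list w i) \<le> length ws" "\<forall>w\<in>set ws. set w \<subseteq> I"
  shows "\<exists>ts. length ts = m \<and> (\<forall>t\<in>set ts. valid I i t) \<and> prefix (map label (lev ts)) ws"
  using assms
proof (induction "length ws" arbitrary: ws m rule: less_induct)
  case less
  show ?case
  proof (cases "m = 0")
    case False
    define us vs where "us = take m ws" and "vs = drop m ws"
    have ws: "ws = us @ vs" "length us = m"
      using less.prems(1) by (auto simp: us_def vs_def)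
    let ?n = "\<Sum>w\<leftarrow>us. count_list w i"
    have "?n + (\<Sum>w\<leftarrow>vs. count_list w i) \<le> length vs" "length vs < length ws"
      using less.prems(1) ws False by auto
    then obtain ns where ns: "length ns = ?n" "\<forall>t\<in>set ns. valid I i t" "prefix (map label (lev ns)) vs"
      using less.hyps[of vs ?n] less.prems(2) ws by auto
    obtain kss where kss: "concat kss = ns" "map length kss = map (\<lambda>w. count_list w i) us"
      using group_list[of "map (\<lambda>w. count_list w i) us" ns] ns by auto
    have len: "length kss = length us" using kss(2) map_eq_imp_length_eq by blast
    define ts where "ts = map2 RNode us kss"
    have lab: "map label ts = us" and kids: "map kids ts = kss"
      using len by (auto simp: ts_def intro!: nth_equalityI)
    have "valid I i t" if t: "t \<in> set ts" for t
    proof -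
      obtain k where k: "k < length us" "t = RNode (us ! k) (kss ! k)"
        using t len unfolding ts_def by (auto simp: in_set_conv_nth)
      moreover have "length (kss ! k) = count_list (us ! k) i"
        using k len arg_cong[OF kss(2), of "\<lambda>l. l ! k"] by simp
      moreover have "kss ! k \<in> set kss" "us ! k \<in> set us" using k len by auto
      ultimately show ?thesis
        using ns(2) kss(1) less.prems(2) ws(1) by auto
    qed
    moreover have "ts \<noteq> []" using lab ws False by auto
    then have "map label (lev ts) = us @ map label (lev ns)"
      by (simp add: lev_nonempty lab kids kss)
    moreover have "length ts = m" using lab ws(2) by (metis length_map)
    ultimately show ?thesis
      using ns(3) ws(1) by (intro exI[of _ ts]) auto
  qed auto
qed

text \<open>One tree at a time: a tree with \<open>n\<close> vertices consumes \<open>n\<close>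
  words with \<open>n - 1\<close> letters \<open>i\<close>, so the inequality survives with one tree
  less.\<close>

lemma forest_decode:
  assumes "m + (\<Sum>w\<leftarrow>ws. count_list w i) \<le> length ws" "\<forall>w\<in>set ws. set w \<subseteq> I"
  shows "\<exists>ts. length ts = m \<and> (\<forall>t\<in>set ts. valid I i t) \<and> prefix (map label (bfs_forest ts)) ws"
  using assms
proof (induction m arbitrary: ws)
  case (Suc m)
  then obtain ts where "length ts = 1" and ts: "\<forall>t\<in>set ts. valid I i t" "prefix (map label (lev ts)) ws"
    using lev_decode[of 1 i ws I] by auto
  then obtain t where t: "ts = [t]" by (cases ts) auto
  obtain vs where vs: "ws = map label (lev ts) @ vs" using ts by (elim prefixE)
  have "m + (\<Sum>w\<leftarrow>vs. count_list w i) \<le> length vs"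
    using Suc.prems(1) sum_list_count_lev[OF ts(1)] t vs by (simp add: comp_def)
  then obtain ts' where "length ts' = m" "\<forall>t\<in>set ts'. valid I i t" "prefix (map label (bfs_forest ts')) vs"
    using Suc.IH[of vs] Suc.prems(2) vs by auto
  then show ?case using t ts vs by (intro exI[of _ "t # ts'"]) auto
qed auto

section \<open>Assembling a forest from its monochromatic subtrees\<close>

fun weight :: "(nat list \<Rightarrow> nat) \<Rightarrow> nat list rtree \<Rightarrow> nat" where
  "weight h (RNode w ks) = h w + sum_list (map (weight h) ks)"

text \<open>With \<open>h\<close> constantly 1 this counts the vertices in the queues and in the
  current generation, a termination measure; with \<open>demand j\<close> for \<open>h\<close> it is
  the outstanding demand for new subtrees of type \<open>j\<close>.\<close>

definition load :: "nat set \<Rightarrow> (nat \<Rightarrow> nat list \<Rightarrow> nat) \<Rightarrow> (nat \<Rightarrow> nat list rtree list) \<Rightarrow>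
    (nat \<times> nat list rtree) list \<Rightarrow> nat" where
  "load I h Q N = (\<Sum>i\<in>I. \<Sum>t\<leftarrow>Q i. weight (h i) t) + (\<Sum>(i, t)\<leftarrow>N. weight (h i) t)"

text \<open>A pair \<open>(i, M)\<close> stands for a vertex of type \<open>i\<close> whose children, from left to right, have the types
and skeletons listed in \<open>M\<close>; \<open>fresh j P\<close> lists the skeletons of those children that start a new subtree
of type \<open>j\<close>.\<close>

definition parent_node :: "nat \<times> (nat \<times> nat list rtree) list \<Rightarrow> nat \<times> nat list rtree" where
  "parent_node = (\<lambda>(i, M). (i, RNode (map fst M) (map snd (filter (\<lambda>p. fst p = i) M))))"

definition fresh :: "nat \<Rightarrow> (nat \<times> (nat \<times> nat list rtree) list) list \<Rightarrow> nat list rtree list" where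
  "fresh j P = concat (map (\<lambda>(i, M). if i = j then [] else map snd (filter (\<lambda>p. fst p = j) M)) P)"

lemma merge_by_word:
  assumes "\<And>j. length (B j) = count_list w j"
  shows "\<exists>M. map fst M = w \<and> (\<forall>j. map snd (filter (\<lambda>p. fst p = j) M) = B j)"
  using assms
proof (induction w arbitrary: B)
  case (Cons a w)
  have "length (B a) = Suc (count_list w a)" using Cons.prems[of a] by simp
  then obtain b bs where b: "B a = b # bs" "length bs = count_list w a"
    by (auto simp: length_Suc_conv)
  have "length ((B(a := bs)) j) = count_list w j" for j
    using Cons.prems[of j] b by auto
  from Cons.IH[OF this] obtain M where
    "map fst M = w" "\<forall>j. map snd (filter (\<lambda>p. fst p = j) M) = (B(a := bs)) j" by blast
  then show ?case using b by (intro exI[of _ "(a, b) # M"]) auto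
qed auto

text \<open>The parents are served from left to right: children of a parent's own type come from its
  skeleton, those of another type \<open>j\<close> from the front of \<open>A j\<close>, which holds
  exactly as many as asked for.\<close>

lemma distribute:
  assumes "\<forall>(i, t)\<in>set N. length (kids t) = count_list (label t) i"
    and "\<And>j. length (A j) = (\<Sum>(i, t)\<leftarrow>N. if i = j then 0 else count_list (label t) j)"
  shows "\<exists>P. map parent_node P = N \<and> (\<forall>j. fresh j P = A j)"
  using assms
proof (induction N arbitrary: A)
  case Nil
  then show ?case by (intro exI[of _ "[]"]) (auto simp: fresh_def)
next
  case (Cons n N)
  obtain i t where n: "n = (i, t)" by fastforce
  define k where "k j = (if i = j then 0 else count_list (label t) j)" for j
  have lenA: "length (A j) = k j + (\<Sum>(i, t)\<leftarrow>N. if i = j then 0 else count_list (label t) j)" for j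
    using Cons.prems(2)[of j] n by (simp add: k_def)
  then have "length (drop (k j) (A j)) = (\<Sum>(i, t)\<leftarrow>N. if i = j then 0 else count_list (label t) j)" for j
    by simp
  then obtain P where P: "map parent_node P = N" "\<And>j. fresh j P = drop (k j) (A j)"
    using Cons.IH[of "\<lambda>j. drop (k j) (A j)"] Cons.prems(1) by auto
  have "length ((\<lambda>j. if j = i then kids t else take (k j) (A j)) j) = count_list (label t) j" for j
    using Cons.prems(1) n lenA[of j] by (auto simp: k_def)
  from merge_by_word[OF this] obtain M where M: "map fst M = label t"
    "\<And>j. map snd (filter (\<lambda>p. fst p = j) M) = (if j = i then kids t else take (k j) (A j))"
    by blast
  have "fresh j ((i, M) # P) = A j" for j
    using P(2)[of j] M(2)[of j] by (cases "i = j") (auto simp: fresh_def k_def)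
  moreover have "map parent_node ((i, M) # P) = n # N"
    using P(1) M n by (simp add: parent_node_def)
  ultimately show ?case by (intro exI[of _ "(i, M) # P"]) simp
qed

text \<open>Trees are built from the bottom up: once the children are realized as trees
  \<open>ns\<close>, adding roots realizes their parents.\<close>

lemma plant_level:
  assumes "map (\<lambda>t. (label t, skel t)) ns = concat (map snd P)"
  shows "\<exists>ts. map (\<lambda>t. (label t, skel t)) ts = map parent_node P \<and> concat (map kids ts) = ns \<and>
    (\<forall>j. map skel (entering j ts) = fresh j P)"
  using assms
proof (induction P arbitrary: ns)
  case Nil
  then show ?case by (intro exI[of _ "[]"]) (auto simp: fresh_def)
next
  case (Cons p P)
  obtain i M where p: "p = (i, M)" by fastforce
  obtain cs ns' where ns: "ns = cs @ ns'" "M = map (\<lambda>t. (label t, skel t)) cs"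
      "map (\<lambda>t. (label t, skel t)) ns' = concat (map snd P)"
    using Cons.prems p by (auto simp: map_eq_append_conv)
  obtain ts where ts: "map (\<lambda>t. (label t, skel t)) ts = map parent_node P" "concat (map kids ts) = ns'"
    "\<And>j. map skel (entering j ts) = fresh j P" using Cons.IH[OF ns(3)] by blast
  have filt: "map snd (filter (\<lambda>p. fst p = j) M) = map skel (filter (\<lambda>c. label c = j) cs)" for j
    unfolding ns(2) by (induction cs) auto
  have "map fst M = map label cs" by (simp add: ns(2) comp_def)
  then show ?case
    using ts ns(1) p filt
    by (intro exI[of _ "RNode i cs # ts"]) (auto simp: parent_node_def fresh_def)
qed

lemma sum_fresh_single:
  fixes g :: "nat \<Rightarrow> nat list rtree \<Rightarrow> nat"
  assumes "finite I" "fst ` set M \<subseteq> I"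
  shows "(\<Sum>j\<in>I. \<Sum>t\<leftarrow>(if i = j then [] else map snd (filter (\<lambda>p. fst p = j) M)). g j t) +
      (\<Sum>t\<leftarrow>map snd (filter (\<lambda>p. fst p = i) M). g i t) = (\<Sum>(j, t)\<leftarrow>M. g j t)"
  using assms(2)
proof (induction M)
  case (Cons p M)
  obtain a b where p: "p = (a, b)" by fastforce
  have a: "a \<in> I" using Cons.prems p by simp
  have "(\<Sum>j\<in>I. \<Sum>t\<leftarrow>(if i = j then [] else map snd (filter (\<lambda>p. fst p = j) (p # M))). g j t) =
    (\<Sum>j\<in>I. (if j = a then (if i = a then 0 else g a b) else 0) +
      (\<Sum>t\<leftarrow>(if i = j then [] else map snd (filter (\<lambda>p. fst p = j) M)). g j t))"
    by (rule sum.cong) (auto simp: p)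
  also have "\<dots> = (if i = a then 0 else g a b) +
      (\<Sum>j\<in>I. \<Sum>t\<leftarrow>(if i = j then [] else map snd (filter (\<lambda>p. fst p = j) M)). g j t)"
    using a assms(1) by (simp add: sum.distrib)
  finally show ?case using Cons p by auto
qed (use assms(1) in simp)

text \<open>Conservation of weight: each child comes from its parent's skeleton or is fresh, so
  replacing parents and fresh skeletons by the children removes only the words of the
  parents.\<close>

lemma sum_fresh:
  assumes "finite I" "\<forall>(i, M)\<in>set P. fst ` set M \<subseteq> I"
  shows "(\<Sum>(i, t)\<leftarrow>map parent_node P. weight (h i) t) + (\<Sum>j\<in>I. \<Sum>t\<leftarrow>fresh j P. weight (h j) t) =
    (\<Sum>(i, t)\<leftarrow>concat (map snd P). weight (h i) t) + (\<Sum>(i, t)\<leftarrow>map parent_node P. h i (label t))"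
  using assms(2)
proof (induction P)
  case (Cons p P)
  obtain i M where p: "p = (i, M)" by fastforce
  have "(\<Sum>j\<in>I. \<Sum>t\<leftarrow>fresh j (p # P). weight (h j) t) =
    (\<Sum>j\<in>I. \<Sum>t\<leftarrow>(if i = j then [] else map snd (filter (\<lambda>p. fst p = j) M)). weight (h j) t) +
    (\<Sum>j\<in>I. \<Sum>t\<leftarrow>fresh j P. weight (h j) t)"
    unfolding sum.distrib[symmetric] by (rule sum.cong) (auto simp: p fresh_def)
  then show ?case
    using Cons sum_fresh_single[OF assms(1), where M = M and i = i and g = "\<lambda>j. weight (h j)"]
    by (simp add: p parent_node_def)
qed (simp add: fresh_def)

text \<open>Children of the parent's own type come with its skeleton and draw on no queue.\<close>

definition demand :: "nat \<Rightarrow> nat \<Rightarrow> nat list \<Rightarrow> nat" where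
  "demand j i w = (if i = j then 0 else count_list w j)"

text \<open>\<open>Q j\<close> is the queue of type \<open>j\<close> skeletons not yet used and \<open>N\<close> the current generation. Passing to
the next generation lowers the supply \<open>length (Q j)\<close> and the outstanding demand by the same amount, so
a queue that is initially long enough never runs dry.\<close>

lemma assemble_levels:
  assumes "finite I"
    and "\<forall>(i, t)\<in>set N. valid I i t" "\<And>i t. t \<in> set (Q i) \<Longrightarrow> valid I i t"
    and "\<And>j. j \<in> I \<Longrightarrow> load I (demand j) Q N \<le> length (Q j)"
  shows "\<exists>ts R. map (\<lambda>t. (label t, skel t)) ts = N \<and>
    (\<forall>j. Q j = map skel (entering j (lev ts)) @ R j) \<and>
    (\<forall>j\<in>I. load I (demand j) Q N + length (R j) = load I (demand j) R [] + length (Q j))"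
  using assms(2-)
proof (induction "load I (\<lambda>_ _. 1) Q N" arbitrary: Q N rule: less_induct)
  case less
  show ?case
  proof (cases "N = []")
    case True
    then show ?thesis by (intro exI[of _ "[]"] exI[of _ Q]) auto
  next
    case False
    define k where "k j = (\<Sum>(i, t)\<leftarrow>N. demand j i (label t))" for j
    have k0: "k j = 0" if "j \<notin> I" for j
    proof -
      have "demand j i (label t) = 0" if "(i, t) \<in> set N" for i t
        using less.prems(1) that \<open>j \<notin> I\<close> set_label_valid[of I i t]
        by (auto simp: demand_def count_list_0_iff)
      then show ?thesis unfolding k_def by (auto simp: sum_list_eq_0_iff)
    qed
    have weight_ge: "h (label t) \<le> weight h t" for h t by (cases t) simp
    have "k j \<le> (\<Sum>(i, t)\<leftarrow>N. weight (demand j i) t)" for j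
      unfolding k_def by (rule sum_list_mono) (auto simp: weight_ge)
    then have "k j \<le> load I (demand j) Q N" for j
      by (simp add: load_def trans_le_add2)
    then have k_le: "k j \<le> length (Q j)" for j
      using less.prems(3)[of j] k0[of j] by (cases "j \<in> I") (simp_all add: order_trans[of "k j" "load I (demand j) Q N"])
    have "\<forall>(i, t)\<in>set N. length (kids t) = count_list (label t) i"
      using less.prems(1) length_kids_valid by fastforce
    moreover have "length (take (k j) (Q j)) = (\<Sum>(i, t)\<leftarrow>N. if i = j then 0 else count_list (label t) j)" for j
      using k_le[of j] by (simp add: k_def demand_def)
    ultimately obtain P where P: "map parent_node P = N" "\<And>j. fresh j P = take (k j) (Q j)"
      using distribute[of N "\<lambda>j. take (k j) (Q j)"] by blast
    define Q' where "Q' j = drop (k j) (Q j)" for j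
    have Q: "Q j = fresh j P @ Q' j" for j by (simp add: P Q'_def)
    have valid_parent: "valid I i (RNode (map fst M) (map snd (filter (\<lambda>p. fst p = i) M)))"
      if "(i, M) \<in> set P" for i M
    proof -
      have "parent_node (i, M) \<in> set N" using that P(1) by force
      then show ?thesis using bspec[OF less.prems(1), of "parent_node (i, M)"]
        by (simp add: parent_node_def del: valid.simps)
    qed
    have letters: "fst ` set M \<subseteq> I" if "(i, M) \<in> set P" for i M
      using valid_parent[OF that] by auto
    \<comment> \<open>With \<open>h\<close> constantly 1 this makes the measure drop; with
      \<open>demand j\<close> the load drops by \<open>k j\<close>, exactly as the queue
      does.\<close>
    have tot: "load I h Q N = load I h Q' (concat (map snd P)) + (\<Sum>(i, t)\<leftarrow>N. h i (label t))" for h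
    proof -
      have "\<forall>(i, M)\<in>set P. fst ` set M \<subseteq> I" using letters by blast
      then show ?thesis
        using sum_fresh[OF assms(1), of P h] by (simp add: load_def P(1) Q sum.distrib)
    qed
    have N': "valid I j t" if jt: "(j, t) \<in> set (concat (map snd P))" for j t
    proof -
      obtain i M where M: "(i, M) \<in> set P" "(j, t) \<in> set M" using jt by auto
      show ?thesis
      proof (cases "i = j")
        case True
        then show ?thesis using valid_parent[OF M(1)] M(2) by force
      next
        case False
        then have "t \<in> set (fresh j P)" using M by (force simp: fresh_def)
        then show ?thesis using Q less.prems(2) by auto
      qed
    qed
    have "(\<Sum>(i, t)\<leftarrow>N. 1::nat) > 0" using False by (cases N) auto
    then have "load I (\<lambda>_ _. 1) Q' (concat (map snd P)) < load I (\<lambda>_ _. 1) Q N"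
      using tot[of "\<lambda>_ _. 1"] by simp
    moreover have "\<forall>(i, t)\<in>set (concat (map snd P)). valid I i t" using N' by blast
    moreover have "\<And>i t. t \<in> set (Q' i) \<Longrightarrow> valid I i t" using Q less.prems(2) by auto
    moreover have len: "length (Q j) = k j + length (Q' j)" for j
      using k_le[of j] by (simp add: Q'_def)
    have "load I (demand j) Q' (concat (map snd P)) \<le> length (Q' j)" if "j \<in> I" for j
      using less.prems(3)[OF that] tot[of "demand j"] len[of j] by (simp add: k_def)
    ultimately obtain ns R where ns: "map (\<lambda>t. (label t, skel t)) ns = concat (map snd P)"
      "\<And>j. Q' j = map skel (entering j (lev ns)) @ R j"
      "\<And>j. j \<in> I \<Longrightarrow> load I (demand j) Q' (concat (map snd P)) + length (R j) = load I (demand j) R [] + length (Q' j)"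
      using less.hyps[of Q' "concat (map snd P)"] by blast
    obtain ts where ts: "map (\<lambda>t. (label t, skel t)) ts = N" "concat (map kids ts) = ns"
      "\<And>j. map skel (entering j ts) = fresh j P"
      using plant_level[OF ns(1)] P(1) by auto
    have "ts \<noteq> []" using ts(1) False by auto
    then have "Q j = map skel (entering j (lev ts)) @ R j" for j
      using Q[of j] ns(2)[of j] ts by (simp add: lev_nonempty)
    moreover have "load I (demand j) Q N + length (R j) = load I (demand j) R [] + length (Q j)"
      if "j \<in> I" for j
      using ns(3)[OF that] tot[of "demand j"] len[of j] by (simp add: k_def)
    ultimately show ?thesis using ts(1) by blast
  qed
qed

text \<open>Each tree is completed before the next root is drawn, matching the order of
  \<open>sub_roots\<close>; the roots still to come are added to the demand.\<close>

lemma assemble_forest: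
  assumes "finite I" "set c \<subseteq> I" "\<And>i t. t \<in> set (Q i) \<Longrightarrow> valid I i t"
    and "\<And>j. j \<in> I \<Longrightarrow> count_list c j + load I (demand j) Q [] \<le> length (Q j)"
  shows "\<exists>f. map label f = c \<and> (\<forall>j. prefix (map skel (sub_roots j f)) (Q j))"
  using assms(2-)
proof (induction c arbitrary: Q)
  case (Cons i c)
  have i: "i \<in> I" using Cons.prems(1) by simp
  obtain t qs where t: "Q i = t # qs" using Cons.prems(3)[OF i] by (cases "Q i") auto
  define Q' where "Q' = Q(i := qs)"
  have Q': "Q j = (if j = i then [t] else []) @ Q' j" for j by (simp add: Q'_def t)
  have tot: "load I (demand j) Q' [(i, t)] = load I (demand j) Q []" for j
  proof -
    have "(\<Sum>k\<in>I. \<Sum>t\<leftarrow>Q k. weight (demand j k) t) =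
       (\<Sum>k\<in>I. (if k = i then weight (demand j i) t else 0) + (\<Sum>t\<leftarrow>Q' k. weight (demand j k) t))"
      by (rule sum.cong) (auto simp: Q')
    then show ?thesis using i assms(1) by (simp add: load_def sum.distrib)
  qed
  have le: "count_list c j + load I (demand j) Q' [(i, t)] \<le> length (Q' j)" if "j \<in> I" for j
    using Cons.prems(3)[OF that] tot[of j] Q'[of j] by (auto split: if_splits)
  have v: "\<And>i t. t \<in> set (Q' i) \<Longrightarrow> valid I i t" using Q' Cons.prems(2) by auto
  obtain us R where us: "map (\<lambda>t. (label t, skel t)) us = [(i, t)]"
      "\<And>j. Q' j = map skel (entering j (lev us)) @ R j"
      "\<And>j. j \<in> I \<Longrightarrow> load I (demand j) Q' [(i, t)] + length (R j) = load I (demand j) R [] + length (Q' j)"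
  proof -
    have a: "\<forall>(i, t)\<in>set [(i, t)]. valid I i t" using Cons.prems(2)[of t i] t by simp
    have b: "load I (demand j) Q' [(i, t)] \<le> length (Q' j)" if "j \<in> I" for j
      using le[OF that] by simp
    have "\<exists>us R. map (\<lambda>t. (label t, skel t)) us = [(i, t)] \<and>
      (\<forall>j. Q' j = map skel (entering j (lev us)) @ R j) \<and>
      (\<forall>j\<in>I. load I (demand j) Q' [(i, t)] + length (R j) = load I (demand j) R [] + length (Q' j))"
      by (rule assemble_levels[OF assms(1) a]) (use v b in auto)
    then show thesis by (elim exE conjE, intro that) simp_all
  qed
  then obtain u where u: "us = [u]" "label u = i" "skel u = t" by auto
  \<comment> \<open>The surplus of a queue over its load is preserved while a tree is built, so it
    still covers the remaining roots.\<close>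
  have "count_list c j + load I (demand j) R [] \<le> length (R j)" if "j \<in> I" for j
    using le[OF that] us(3)[OF that] by simp
  then obtain f where f: "map label f = c" "\<And>j. prefix (map skel (sub_roots j f)) (R j)"
    using Cons.IH[of R] v us(2) Cons.prems(1) by auto
  have "prefix (map skel (sub_roots j (u # f))) (Q j)" for j
    using Q'[of j] us(2)[of j] u f(2)[of j] by auto
  then show ?case using f(1) u(2) by (intro exI[of _ "u # f"]) auto
qed auto

section \<open>From balanced word families to forests\<close>

lemma weight_conv_lev: "(\<Sum>t\<leftarrow>ts. weight h t) = (\<Sum>w\<leftarrow>map label (lev ts). h w)"
proof (induction ts rule: lev.induct)
  case (1 ts)
  show ?case
  proof (cases "ts = []")
    case False
    have "weight h t = h (label t) + (\<Sum>t\<leftarrow>kids t. weight h t)" for t by (cases t) simp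
    then have "(\<Sum>t\<leftarrow>ts. weight h t) = (\<Sum>t\<leftarrow>ts. h (label t)) + (\<Sum>t\<leftarrow>concat (map kids ts). weight h t)"
      by (induction ts) auto
    then show ?thesis using 1[OF False] by (simp add: lev_nonempty False comp_def)
  qed simp
qed

lemma weight_conv_bfs_forest: "(\<Sum>t\<leftarrow>ts. weight h t) = (\<Sum>w\<leftarrow>map label (bfs_forest ts). h w)"
  using weight_conv_lev[of h "[_]"] by (induction ts) (simp_all add: comp_def)

lemma sum_list_prefix_le: "prefix xs ys \<Longrightarrow> (\<Sum>x\<leftarrow>xs. g x) \<le> (\<Sum>y\<leftarrow>ys. (g y :: nat))"
  by (auto elim!: prefixE)

text \<open>Supply equals demand for every type: the solution equation in natural numbers, with the
  steps -1 of the diagonal walks collected into \<open>length (ws j)\<close>.\<close>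

definition balanced :: "nat set \<Rightarrow> nat list \<Rightarrow> (nat \<Rightarrow> nat list list) \<Rightarrow> bool" where
  "balanced I c ws \<longleftrightarrow>
     (\<forall>j\<in>I. count_list c j + (\<Sum>i\<in>I. \<Sum>w\<leftarrow>ws i. count_list w j) = length (ws j))"

lemma balanced_assemble:
  assumes "finite I" "set c \<subseteq> I" "\<And>i w. w \<in> set (ws i) \<Longrightarrow> set w \<subseteq> I"
    and "\<And>i. i \<notin> I \<Longrightarrow> ws i = []" and "balanced I c ws"
  shows "\<exists>f. root_types f = c \<and> (\<forall>j. prefix (code j f) (ws j))"
proof -
  \<comment> \<open>The number of skeletons of type \<open>j\<close> to decode: one for each root of
    that type and each demand from another type. Balance then gives the inequality that decoding
    requires.\<close>
  define k where "k j = (if j \<in> I then count_list c j + (\<Sum>i\<in>I - {j}. \<Sum>w\<leftarrow>ws i. count_list w j) else 0)" for j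
  have "k j + (\<Sum>w\<leftarrow>ws j. count_list w j) \<le> length (ws j)" for j
    using assms(1,4,5) by (auto simp: k_def balanced_def sum.remove)
  then have "\<exists>ts. length ts = k j \<and> (\<forall>t\<in>set ts. valid I j t) \<and> prefix (map label (bfs_forest ts)) (ws j)" for j
    by (rule forest_decode) (use assms(3) in blast)
  then obtain Q where Q: "\<And>j. length (Q j) = k j" "\<And>j. \<forall>t\<in>set (Q j). valid I j t"
      "\<And>j. prefix (map label (bfs_forest (Q j))) (ws j)"
    by metis
  have "count_list c j + load I (demand j) Q [] \<le> length (Q j)" if "j \<in> I" for j
  proof -
    have "load I (demand j) Q [] = (\<Sum>i\<in>I. \<Sum>w\<leftarrow>map label (bfs_forest (Q i)). demand j i w)"
      by (simp add: load_def weight_conv_bfs_forest)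
    \<comment> \<open>The decoded skeletons use only prefixes of the words, so their demand is at
      most the one counted in \<open>k\<close>.\<close>
    also have "\<dots> \<le> (\<Sum>i\<in>I. \<Sum>w\<leftarrow>ws i. demand j i w)"
      using Q(3) by (intro sum_mono sum_list_prefix_le)
    also have "\<dots> = (\<Sum>i\<in>I - {j}. \<Sum>w\<leftarrow>ws i. count_list w j)"
      using assms(1) that by (simp add: sum.remove demand_def)
    finally show ?thesis using that by (simp add: Q(1) k_def)
  qed
  then obtain f where f: "map label f = c" "\<And>j. prefix (map skel (sub_roots j f)) (Q j)"
    using assemble_forest[OF assms(1,2), of Q] Q(2) by blast
  have "prefix (code j f) (map label (bfs_forest (Q j)))" for j
    using f(2)[of j] by (auto simp: code_conv_skel elim!: prefixE)
  then show ?thesis using f(1) Q(3) prefix_order.trans unfolding root_types_def by blast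
qed

text \<open>Self-delimiting codes turn prefixes of word lists into prefixes of skeleton lists, and
  the assembly is deterministic even up to leftover skeletons.\<close>

lemma code_unique:
  assumes "root_types f = root_types f'" "\<And>j. prefix (code j f) (code j f')"
  shows "f = f'"
proof -
  have v: "\<forall>t\<in>set (map skel (sub_roots j f)). valid UNIV j t" for j f
    using valid_skel label_sub_roots by fastforce
  have "prefix (map skel (sub_roots j f)) (map skel (sub_roots j f'))" for j
    using forest_valid_prefix[OF v v] assms(2) by (simp add: code_conv_skel)
  then have "\<forall>j. \<exists>R. map skel (sub_roots j f') = map skel (sub_roots j f) @ R"
    by (auto simp: prefix_def)
  then obtain R where "\<And>j. map skel (sub_roots j f') = map skel (sub_roots j f) @ R j" by metis
  then show ?thesis
    using assms(1) by (intro forest_unique[where R = R and R' = "\<lambda>_. []"]) (auto simp: root_types_def)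
qed

section \<open>Counting vertices by type\<close>

text \<open>Counting can forget the order: a forest and its subforests list the vertices of one type
  in different breadth-first orders, but the multisets agree.\<close>

fun verts :: "'a rtree \<Rightarrow> 'a rtree multiset" where
  "verts (RNode a cs) = add_mset (RNode a cs) (\<Sum>c\<leftarrow>cs. verts c)"

lemma verts_conv_kids: "verts t = add_mset t (\<Sum>c\<leftarrow>kids t. verts c)"
  by (cases t) simp

lemma mset_lev: "mset (lev ts) = (\<Sum>t\<leftarrow>ts. verts t)"
proof (induction ts rule: lev.induct)
  case (1 ts)
  show ?case
  proof (cases "ts = []")
    case False
    have "(\<Sum>t\<leftarrow>ts. verts t) = mset ts + (\<Sum>c\<leftarrow>concat (map kids ts). verts c)"
    proof (induction ts)
      case (Cons t ts)
      then show ?case using verts_conv_kids[of t] by simp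
    qed simp
    then show ?thesis using 1[OF False] False by (simp add: lev_nonempty)
  qed simp
qed

lemma mset_bfs_forest: "mset (bfs_forest f) = (\<Sum>t\<leftarrow>f. verts t)"
  by (induction f) (simp_all add: mset_lev)

lemma in_sum_list_mset_iff: "v \<in># (\<Sum>x\<leftarrow>xs. h x) \<longleftrightarrow> (\<exists>x\<in>set xs. v \<in># h x)"
  by (induction xs) auto

definition block :: "nat \<Rightarrow> nat rtree \<Rightarrow> nat rtree multiset" where
  "block i v = image_mset label (verts (msub i v))"

lemma image_mset_sum_list: "image_mset g (\<Sum>x\<leftarrow>xs. h x) = (\<Sum>x\<leftarrow>xs. image_mset g (h x))"
  by (induction xs) auto

lemma block_RNode:
  "block i (RNode a cs) = add_mset (RNode a cs) (\<Sum>c\<leftarrow>filter (\<lambda>c. label c = i) cs. block i c)"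
proof -
  have "concat (map (\<lambda>c. if label c = i then [msub i c] else []) cs) = map (msub i) (filter (\<lambda>c. label c = i) cs)"
    by (induction cs) auto
  then show ?thesis by (simp add: block_def image_mset_sum_list comp_def)
qed

definition entering_kids :: "nat \<Rightarrow> nat rtree \<Rightarrow> nat rtree list" where
  "entering_kids i v = (if label v = i then [] else filter (\<lambda>c. label c = i) (kids v))"

text \<open>Each vertex of type \<open>i\<close> lies in exactly one maximal subtree of that type,
  whose root is the root of \<open>t\<close> or a child of a vertex of another type.\<close>

lemma filter_verts_conv_block:
  "filter_mset (\<lambda>v. label v = i) (verts t) =
     (if label t = i then block i t else {#}) +
     (\<Sum>v\<in>#verts t. \<Sum>c\<leftarrow>entering_kids i v. block i c)"
proof (induction t)
  case (RNode a cs)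
  let ?e = "\<lambda>v. \<Sum>c\<leftarrow>entering_kids i v. block i c"
  have "filter_mset (\<lambda>v. label v = i) (\<Sum>c\<leftarrow>cs'. verts c) =
    (\<Sum>c\<leftarrow>filter (\<lambda>c. label c = i) cs'. block i c) + (\<Sum>v\<in>#(\<Sum>c\<leftarrow>cs'. verts c). ?e v)"
    if "set cs' \<subseteq> set cs" for cs'
    using that RNode.IH by (induction cs') auto
  from this[OF subset_refl] show ?case
    by (simp add: block_RNode) (simp add: entering_kids_def)
qed

lemma sum_mset_mset_map: "(\<Sum>x\<in>#mset xs. g x) = (\<Sum>x\<leftarrow>xs. g x)"
  by (simp flip: sum_mset_sum_list)

lemma mset_sub_verts: "mset (sub_verts i f) = filter_mset (\<lambda>v. label v = i) (mset (bfs_forest f))"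
proof -
  have "mset (sub_verts i f) = (\<Sum>v\<leftarrow>sub_roots i f. block i v)"
    by (simp add: sub_verts_def subforest_conv_sub_roots mset_bfs_forest image_mset_sum_list block_def comp_def)
  also have "\<dots> = filter_mset (\<lambda>v. label v = i) (mset (bfs_forest f))"
  proof (induction f)
    case (Cons t f)
    have "(\<Sum>v\<leftarrow>entering i ts. block i v) = (\<Sum>v\<in>#mset ts. \<Sum>c\<leftarrow>entering_kids i v. block i c)" for ts
      by (induction ts) (auto simp: entering_kids_def)
    then show ?case using Cons filter_verts_conv_block[of i t] by (simp add: mset_lev)
  qed simp
  finally show ?thesis .
qed

lemma length_code: "length (code i f) = length (filter (\<lambda>v. label v = i) (bfs_forest f))"
  using arg_cong[OF mset_sub_verts[of i f], of size] by (simp add: code_def flip: mset_filter)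

lemma set_code: "set (code i f) = (\<lambda>v. map label (kids v)) ` {v \<in> set (bfs_forest f). label v = i}"
  using arg_cong[OF mset_sub_verts[of i f], of set_mset] by (simp add: code_def)

lemma sum_list_code:
  "(\<Sum>w\<leftarrow>code i f. g w) = (\<Sum>v\<leftarrow>filter (\<lambda>v. label v = i) (bfs_forest f). (g (map label (kids v)) :: nat))"
proof -
  have "(\<Sum>w\<leftarrow>code i f. g w) = (\<Sum>v\<in>#mset (sub_verts i f). g (map label (kids v)))"
    by (simp add: code_def sum_mset_mset_map comp_def)
  also have "\<dots> = (\<Sum>v\<in>#mset (filter (\<lambda>v. label v = i) (bfs_forest f)). g (map label (kids v)))"
    by (simp add: mset_sub_verts)
  finally show ?thesis by (simp only: sum_mset_mset_map)
qed

text \<open>Every vertex but the root is a child of exactly one vertex.\<close>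

lemma count_type_verts:
  "size (filter_mset (\<lambda>v. label v = j) (verts t)) =
     (if label t = j then 1 else 0) + (\<Sum>v\<in>#verts t. count_list (map label (kids v)) j)"
proof (induction t)
  case (RNode a cs)
  have "size (filter_mset (\<lambda>v. label v = j) (\<Sum>c\<leftarrow>cs'. verts c)) =
    count_list (map label cs') j + (\<Sum>v\<in>#(\<Sum>c\<leftarrow>cs'. verts c). count_list (map label (kids v)) j)"
    if "set cs' \<subseteq> set cs" for cs'
    using that RNode.IH by (induction cs') auto
  from this[OF subset_refl] show ?case by simp
qed

lemma count_type_forest:
  "length (filter (\<lambda>v. label v = j) (bfs_forest f)) =
     count_list (root_types f) j + (\<Sum>v\<leftarrow>bfs_forest f. count_list (map label (kids v)) j)"
proof (induction f)
  case (Cons t f)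
  have "length (filter (\<lambda>v. label v = j) (lev [t])) = size (filter_mset (\<lambda>v. label v = j) (mset (lev [t])))"
    by (simp flip: mset_filter)
  also have "\<dots> = (if label t = j then 1 else 0) + (\<Sum>v\<leftarrow>lev [t]. count_list (map label (kids v)) j)"
    using count_type_verts[of j t] unfolding sum_mset_mset_map[symmetric] by (simp add: mset_lev)
  finally show ?case using Cons by (simp add: root_types_def)
qed (simp add: root_types_def)

lemma sum_filter_types:
  assumes "finite I" "\<forall>v\<in>set vs. k v \<in> I"
  shows "(\<Sum>i\<in>I. \<Sum>v\<leftarrow>filter (\<lambda>v. k v = i) vs. (g v :: nat)) = (\<Sum>v\<leftarrow>vs. g v)"
  using assms(2)
proof (induction vs)
  case (Cons v vs)
  have "(\<Sum>i\<in>I. \<Sum>v\<leftarrow>filter (\<lambda>v. k v = i) (v # vs). g v) =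
    (\<Sum>i\<in>I. (if i = k v then g v else 0) + (\<Sum>v\<leftarrow>filter (\<lambda>v. k v = i) vs. g v))"
    by (rule sum.cong) auto
  then show ?case using Cons assms(1) by (simp add: sum.distrib)
qed simp

text \<open>The vertices of type \<open>j\<close> are roots or children, and the latter can be
  grouped by the type of the parent.\<close>

lemma balanced_code:
  assumes "finite I" "\<forall>v\<in>set (bfs_forest f). label v \<in> I"
  shows "balanced I (root_types f) (\<lambda>i. code i f)"
  unfolding balanced_def sum_list_code length_code count_type_forest sum_filter_types[OF assms]
  by simp

text \<open>A sorted word is determined by its letter counts, so nothing is lost when
  \<open>Psi\<close> keeps only the counts.\<close>

definition words_over :: "nat \<Rightarrow> nat list list \<Rightarrow> bool" where
  "words_over d ws \<longleftrightarrow> (\<forall>w\<in>set ws. sorted w \<and> set w \<subseteq> {1..d})"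

lemma words_over_code:
  assumes "dtype_forest d f"
  shows "words_over d (code i f)"
proof -
  \<comment> \<open>Children of vertices are again vertices, so \<open>dtype_forest\<close> also
    constrains the letters of the words.\<close>
  have kid: "c \<in> set (bfs_forest f)" if "v \<in> set (bfs_forest f)" "c \<in> set (kids v)" for c v
  proof -
    have "c \<in># verts t" if "v \<in># verts t" for t
      using that
    proof (induction t)
      case (RNode a cs)
      have c: "c \<in># verts c" by (simp add: verts_conv_kids[of c])
      show ?case
      proof (cases "v = RNode a cs")
        case True
        then show ?thesis using c \<open>c \<in> set (kids v)\<close> by (auto simp: in_sum_list_mset_iff)
      next
        case False
        then show ?thesis using RNode by (auto simp: in_sum_list_mset_iff)
      qed
    qed
    moreover have "set (bfs_forest f) = (\<Union>t\<in>set f. set_mset (verts t))"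
      using arg_cong[OF mset_bfs_forest[of f], of set_mset] by (auto simp: in_sum_list_mset_iff)
    ultimately show ?thesis using that(1) by auto
  qed
  then show ?thesis using assms unfolding words_over_def set_code dtype_forest_def by fastforce
qed

lemma dtype_forest_if_words_over:
  assumes "\<And>i. words_over d (code i f)" "\<And>i. i \<notin> {1..d} \<Longrightarrow> code i f = []"
  shows "dtype_forest d f"
  unfolding dtype_forest_def
proof
  fix v assume v: "v \<in> set (bfs_forest f)"
  then have "map label (kids v) \<in> set (code (label v) f)" by (auto simp: set_code)
  then show "label v \<in> {1..d} \<and> sorted (map label (kids v))"
    using assms(1)[of "label v"] assms(2)[of "label v"] unfolding words_over_def by fastforce
qed

section \<open>Word families and integer walks\<close>

definition step :: "nat \<Rightarrow> nat \<Rightarrow> nat list \<Rightarrow> int" where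
  "step i j w = int (count_list w j) - (if i = j then 1 else 0)"

definition walk :: "nat \<Rightarrow> (nat \<Rightarrow> nat list list) \<Rightarrow> int list list list" where
  "walk d ws = map (\<lambda>i. map (\<lambda>n. map (\<lambda>j. \<Sum>m<n. step i j (ws i ! m)) [1..<Suc d])
     [0..<Suc (length (ws i))]) [1..<Suc d]"

lemma Psi_conv_walk: "Psi d f = walk d (\<lambda>i. code i f)"
proof -
  have "(\<Sum>m<n. int (nchild j (sub_verts i f ! m)) - (if i = j then 1 else 0)) =
      (\<Sum>m<n. step i j (code i f ! m))" if "n < Suc (length (sub_verts i f))" for i j n
    using that by (intro sum.cong) (auto simp: step_def code_def nchild_def count_list_map_label)
  moreover have "length (code i f) = length (sub_verts i f)" for i by (simp add: code_def)
  ultimately show ?thesis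
    unfolding Psi_def walk_def Let_def by (auto simp del: upt_Suc intro!: map_cong)
qed

context
  fixes d i :: nat and ws :: "nat \<Rightarrow> nat list list"
  assumes i: "i \<in> {1..d}"
begin

lemma walk_nth: "walk d ws ! (i - 1) =
    map (\<lambda>n. map (\<lambda>j. \<Sum>m<n. step i j (ws i ! m)) [1..<Suc d]) [0..<Suc (length (ws i))]"
proof -
  have "i - 1 < length [1..<Suc d]" "[1..<Suc d] ! (i - 1) = i" using i by (auto simp del: upt_Suc)
  then show ?thesis unfolding walk_def by (subst nth_map) (simp_all del: upt_Suc)
qed

lemma xlen_walk: "xlen (walk d ws) i = length (ws i)"
  unfolding xlen_def walk_nth by simp

lemma xc_walk:
  assumes "j \<in> {1..d}" "n \<le> length (ws i)"
  shows "xc (walk d ws) i j n = (\<Sum>m<n. step i j (ws i ! m))"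
proof -
  have "j - 1 < length [1..<Suc d]" "[1..<Suc d] ! (j - 1) = j" using assms(1) by (auto simp del: upt_Suc)
  then show ?thesis
    using assms(2) unfolding xc_def walk_nth by (simp del: upt_Suc)
qed

lemma xc_walk_conv_take:
  assumes "j \<in> {1..d}" "n \<le> length (ws i)"
  shows "xc (walk d ws) i j n = int (\<Sum>w\<leftarrow>take n (ws i). count_list w j) - (if i = j then int n else 0)"
proof -
  have "(\<Sum>w\<leftarrow>take n (ws i). count_list w j) = (\<Sum>m<n. count_list (ws i ! m) j)"
    using assms(2) by (simp add: sum_list_sum_nth atLeast0LessThan)
  then show ?thesis using assms by (simp add: xc_walk step_def sum_subtractf)
qed

end

lemma in_Sd_walk: "in_Sd d (walk d ws)"
proof -
  have "length (walk d ws) = d" by (simp add: walk_def)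
  moreover have "walk d ws ! (i - 1) \<noteq> [] \<and> (\<forall>n\<le>xlen (walk d ws) i. length (walk d ws ! (i - 1) ! n) = d)"
    if "i \<in> {1..d}" for i
    unfolding xlen_walk[OF that] walk_nth[OF that] by (auto simp del: upt_Suc)
  ultimately show ?thesis
    unfolding in_Sd_def by (simp add: xlen_walk xc_walk step_def)
qed

text \<open>The steps -1 on the diagonal contribute \<open>- s j\<close> to coordinate
  \<open>j\<close>; moved to the other side, they leave an equation of natural numbers.\<close>

lemma is_solution_walk:
  "is_solution d r (walk d ws) s \<longleftrightarrow> (\<forall>i\<in>{1..d}. s i \<le> length (ws i)) \<and>
     (\<forall>j\<in>{1..d}. r j + (\<Sum>i\<in>{1..d}. \<Sum>w\<leftarrow>take (s i) (ws i). count_list w j) = s j)"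
proof -
  have *: "int (r j) + (\<Sum>i=1..d. xc (walk d ws) i j (s i)) =
      int (r j + (\<Sum>i\<in>{1..d}. \<Sum>w\<leftarrow>take (s i) (ws i). count_list w j)) - int (s j)"
    if "\<forall>i\<in>{1..d}. s i \<le> length (ws i)" "j \<in> {1..d}" for j
  proof -
    have "(\<Sum>i=1..d. xc (walk d ws) i j (s i)) =
      (\<Sum>i=1..d. int (\<Sum>w\<leftarrow>take (s i) (ws i). count_list w j) - (if i = j then int (s j) else 0))"
      using that by (intro sum.cong) (simp_all add: xc_walk_conv_take)
    then show ?thesis using that(2) by (simp add: sum_subtractf)
  qed
  have "(int (r j) + (\<Sum>i=1..d. xc (walk d ws) i j (s i)) = 0) =
      (r j + (\<Sum>i\<in>{1..d}. \<Sum>w\<leftarrow>take (s i) (ws i). count_list w j) = s j)"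
    if "\<forall>i\<in>{1..d}. s i \<le> length (ws i)" "j \<in> {1..d}" for j
    unfolding *[OF that] by linarith
  then show ?thesis
    unfolding is_solution_def by (auto simp: xlen_walk)
qed

lemma sorted_eq_if_count_list_eq:
  fixes xs ys :: "nat list"
  assumes "sorted xs" "sorted ys" "\<And>j. count_list xs j = count_list ys j"
  shows "xs = ys"
proof -
  have "mset xs = mset ys" using assms(3) by (intro multiset_eqI) (simp add: count_mset)
  then show ?thesis using assms(1,2) properties_for_sort sorted_sort_id by metis
qed

text \<open>Increments of the walk give the counts of the letters in \<open>{1..d}\<close>, no other
  letters occur, and sorted words are determined by their counts.\<close>

lemma walk_inj:
  assumes "walk d ws = walk d ws'" "words_over d (ws i)" "words_over d (ws' i)" "i \<in> {1..d}"
  shows "ws i = ws' i"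
proof (rule nth_equalityI)
  show len: "length (ws i) = length (ws' i)"
    using assms(1,4) xlen_walk by metis
  fix m assume m: "m < length (ws i)"
  then have in_ws: "ws i ! m \<in> set (ws i)" "ws' i ! m \<in> set (ws' i)" using len by auto
  have "count_list (ws i ! m) j = count_list (ws' i ! m) j" for j
  proof (cases "j \<in> {1..d}")
    case True
    have "step i j (vs i ! m) = xc (walk d vs) i j (Suc m) - xc (walk d vs) i j m"
      if "m < length (vs i)" for vs
      using that by (simp add: xc_walk[OF assms(4) True])
    then have "step i j (ws i ! m) = step i j (ws' i ! m)" using m len assms(1) by simp
    then show ?thesis by (simp add: step_def)
  next
    case False
    then show ?thesis
      using in_ws assms(2,3) count_list_0_iff unfolding words_over_def by (metis subsetD)
  qed
  then show "ws i ! m = ws' i ! m"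
    using in_ws assms(2,3) sorted_eq_if_count_list_eq unfolding words_over_def by blast
qed

lemma sorted_word: "sorted (concat (map (\<lambda>j. replicate (k j) j) [1..<Suc d]))"
  by (induction d) (auto simp: sorted_append sorted_replicate)

lemma count_list_word:
  "count_list (concat (map (\<lambda>j. replicate (k j) j) [1..<Suc d])) j = (if j \<in> {1..d} then k j else 0)"
proof -
  have "count_list (replicate n a) j = (if a = j then n else 0)" for n a by (induction n) auto
  then show ?thesis by (induction d) auto
qed

lemma walk_surj:
  assumes "in_Sd d x"
  shows "\<exists>ws. (\<forall>i. words_over d (ws i)) \<and> (\<forall>i. i \<notin> {1..d} \<longrightarrow> ws i = []) \<and> x = walk d ws"
proof -
  \<comment> \<open>The increments of \<open>x\<close> are read as letter counts, with 1 added back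
    on the diagonal. Within the length of \<open>x\<close> they are nonnegative, so
    \<open>nat\<close> does not truncate there.\<close>
  define k where "k i n j = nat (xc x i j (Suc n) - xc x i j n + (if i = j then 1 else 0))" for i n j
  define word where "word i n = concat (map (\<lambda>j. replicate (k i n j) j) [1..<Suc d])" for i n
  define ws where "ws i = (if i \<in> {1..d} then map (word i) [0..<xlen x i] else [])" for i
  have "sorted (word i n) \<and> set (word i n) \<subseteq> {1..d}" for i n
    unfolding word_def using sorted_word by auto
  then have "words_over d (ws i)" for i by (auto simp: words_over_def ws_def)
  moreover have "x = walk d ws"
  proof (rule nth_equalityI)
    have x: "length x = d" using assms by (simp add: in_Sd_def)
    then show "length x = length (walk d ws)" by (simp add: walk_def)
    fix i' assume "i' < length x"
    then obtain i where i: "i \<in> {1..d}" "i' = i - 1" using x by (intro that[of "Suc i'"]) auto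
    have len: "length (x ! (i - 1)) = Suc (xlen x i)"
      using assms i(1) by (auto simp: in_Sd_def xlen_def)
    have lw: "length (ws i) = xlen x i" using i by (simp add: ws_def)
    have incr: "(j \<noteq> i \<longrightarrow> xc x i j n \<le> xc x i j (Suc n)) \<and> xc x i i (Suc n) - xc x i i n \<ge> - 1"
      if "j \<in> {1..d}" "n < xlen x i" for j n
      using assms i(1) that unfolding in_Sd_def by blast
    have tele: "xc x i j n = (\<Sum>m<n. step i j (ws i ! m))" if "j \<in> {1..d}" "n \<le> xlen x i" for j n
      using that(2)
    proof (induction n)
      case 0
      then show ?case using assms i(1) that(1) by (simp add: in_Sd_def)
    next
      case (Suc n)
      have "xc x i j (Suc n) - xc x i j n + (if i = j then 1 else 0) \<ge> 0"
        using incr[of j n] that(1) Suc.prems by (auto simp: Suc_le_eq)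
      then have "int (k i n j) = xc x i j (Suc n) - xc x i j n + (if i = j then 1 else 0)"
        by (simp add: k_def)
      moreover have "count_list (word i n) j = k i n j"
        using that(1) unfolding word_def count_list_word by simp
      ultimately have "step i j (ws i ! n) = xc x i j (Suc n) - xc x i j n"
        using i(1) Suc.prems by (simp add: step_def ws_def)
      then show ?case using Suc by simp
    qed
    show "x ! i' = walk d ws ! i'"
    proof (rule nth_equalityI)
      show "length (x ! i') = length (walk d ws ! i')"
        unfolding i(2) walk_nth[OF i(1)] len by (simp add: lw)
      fix n assume "n < length (x ! i')"
      then have n: "n \<le> xlen x i" using len i by simp
      show "x ! i' ! n = walk d ws ! i' ! n"
      proof (rule nth_equalityI)
        have xn: "length (x ! i' ! n) = d" using assms i n by (auto simp: in_Sd_def)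
        have "length (walk d ws ! (i - 1) ! n) = d"
          using in_Sd_walk[of d ws] i(1) n by (simp add: in_Sd_def xlen_walk lw)
        then show "length (x ! i' ! n) = length (walk d ws ! i' ! n)" using xn i by simp
        fix j' assume "j' < length (x ! i' ! n)"
        then obtain j where j: "j \<in> {1..d}" "j' = j - 1" using xn by (intro that[of "Suc j'"]) auto
        have "xc x i j n = xc (walk d ws) i j n"
          using tele[OF j(1) n] xc_walk[OF i(1) j(1), of n ws] n lw by simp
        then show "x ! i' ! n ! j' = walk d ws ! i' ! n ! j'"
          by (simp add: xc_def i(2) j(2))
      qed
    qed
  qed
  ultimately show ?thesis by (intro exI[of _ ws]) (auto simp: ws_def)
qed

lemma take_length_prefix: "prefix xs ys \<Longrightarrow> take (length xs) ys = xs"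
  by (auto elim: prefixE)

section \<open>The bijection\<close>

lemma Psi_in_Sdr:
  assumes f: "f \<in> Fdr d r"
  shows "Psi d f \<in> Sdr d r"
proof -
  let ?I = "{1..d}" and ?c = "root_types f" and ?n = "\<lambda>i. length (code i f)"
  have dt: "dtype_forest d f" and c: "set ?c \<subseteq> ?I" "\<And>j. j \<in> ?I \<Longrightarrow> count_list ?c j = r j"
    using f by (auto simp: Fdr_def Cdr_def)
  have bal: "balanced ?I ?c (\<lambda>i. code i f)"
    using dt by (intro balanced_code) (auto simp: dtype_forest_def)
  have sol: "is_solution d r (Psi d f) ?n"
    using bal c(2) by (simp add: Psi_conv_walk is_solution_walk balanced_def)
  have "?n i \<le> s i" if s: "is_solution d r (Psi d f) s" and i: "i \<in> ?I" for s i
  proof -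
    \<comment> \<open>The code truncated at an arbitrary solution \<open>s\<close> is again
      balanced, so it can be assembled.\<close>
    define ws where "ws i = (if i \<in> ?I then take (s i) (code i f) else [])" for i
    have pre: "prefix (ws i) (code i f)" for i by (simp add: ws_def take_is_prefix)
    have s': "s i \<le> ?n i" if "i \<in> ?I" for i
      using s that by (simp add: Psi_conv_walk is_solution_walk)
    have "balanced ?I ?c ws"
      using s c(2) s' by (simp add: Psi_conv_walk is_solution_walk balanced_def ws_def)
    moreover have "set w \<subseteq> ?I" if "w \<in> set (ws i)" for i w
      using that words_over_code[OF dt, of i] set_mono_prefix[OF pre[of i]]
      unfolding words_over_def by blast
    moreover have "ws i = []" if "i \<notin> ?I" for i using that by (simp only: ws_def if_False)
    ultimately obtain f' where f': "root_types f' = ?c" "\<And>j. prefix (code j f') (ws j)"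
      using balanced_assemble[OF finite_atLeastAtMost c(1), of ws] by blast
    \<comment> \<open>The code of \<open>f'\<close> is a prefix of the truncated code, hence of the
      code of \<open>f\<close>; so the truncation at \<open>s\<close> already contains the whole
      code of \<open>f\<close>.\<close>
    have "f' = f"
      using f' pre prefix_order.trans by (intro code_unique) blast+
    then have "?n i \<le> length (ws i)" using f'(2)[of i] prefix_length_le by blast
    then show ?thesis using i s' by (simp add: ws_def)
  qed
  moreover have "xlen (Psi d f) i = ?n i" if "i \<in> ?I" for i
    using that by (simp add: Psi_conv_walk xlen_walk)
  moreover have "?n i \<ge> 1" if "i \<in> ?I" for i
    using f that by (auto simp: Fdr_def length_code Suc_le_eq filter_empty_conv)
  moreover have "is_solution d r (Psi d f) (xlen (Psi d f))"
    using sol by (simp add: Psi_conv_walk is_solution_walk xlen_walk)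
  ultimately show ?thesis
    unfolding Sdr_def smallest_solution_def by (simp add: Psi_conv_walk in_Sd_walk)
qed

lemma Phi_surj:
  assumes x: "x \<in> Sdr d r" and c: "c \<in> Cdr d r"
  shows "\<exists>f\<in>Fdr d r. Phi d f = (x, c)"
proof -
  let ?I = "{1..d}"
  obtain ws where ws: "\<And>i. words_over d (ws i)" "\<And>i. i \<notin> ?I \<Longrightarrow> ws i = []" "x = walk d ws"
    using x walk_surj unfolding Sdr_def by blast
  have cI: "set c \<subseteq> ?I" "\<And>j. j \<in> ?I \<Longrightarrow> count_list c j = r j"
    using c by (auto simp: Cdr_def)
  have sol: "is_solution d r x (xlen x)" and
    least: "\<And>s i. is_solution d r x s \<Longrightarrow> i \<in> ?I \<Longrightarrow> xlen x i \<le> s i" and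
    pos: "\<And>i. i \<in> ?I \<Longrightarrow> xlen x i \<ge> 1"
    using x by (auto simp: Sdr_def smallest_solution_def)
  have "balanced ?I c ws"
    using sol cI(2) by (simp add: ws(3) is_solution_walk balanced_def xlen_walk)
  then obtain f where f: "root_types f = c" "\<And>j. prefix (code j f) (ws j)"
    using balanced_assemble[of ?I c ws] cI(1) ws(1,2) unfolding words_over_def by auto
  have nil: "code i f = []" if "i \<notin> ?I" for i using f(2)[of i] ws(2)[OF that] by simp
  have dt: "dtype_forest d f"
    using ws(1) set_mono_prefix[OF f(2)] nil
    by (intro dtype_forest_if_words_over) (auto simp: words_over_def)
  have bal: "balanced ?I c (\<lambda>i. code i f)"
    unfolding f(1)[symmetric] using dt by (intro balanced_code) (auto simp: dtype_forest_def)
  \<comment> \<open>The code of the assembled forest gives a solution below the length of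
    \<open>x\<close>; minimality of that length forces every word to be used.\<close>
  have "is_solution d r x (\<lambda>i. length (code i f))"
    using bal cI(2) prefix_length_le[OF f(2)] take_length_prefix[OF f(2)]
    by (simp add: ws(3) is_solution_walk balanced_def)
  then have le: "length (ws i) \<le> length (code i f)" if "i \<in> ?I" for i
    using least that by (simp add: ws(3) xlen_walk)
  have "code i f = ws i" for i
    using le[of i] f(2)[of i] nil[of i] ws(2)[of i] by (cases "i \<in> ?I") (auto simp: prefix_def)
  then have eq: "(\<lambda>i. code i f) = ws" by blast
  have "\<exists>v\<in>set (bfs_forest f). label v = i" if "i \<in> ?I" for i
  proof -
    have "length (code i f) \<ge> 1" using pos[OF that] that eq by (auto simp: ws(3) xlen_walk)
    then show ?thesis by (auto simp: length_code Suc_le_eq filter_empty_conv)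
  qed
  moreover have "length f = (\<Sum>i=1..d. r i)"
    using f(1) c by (auto simp: root_types_def Cdr_def)
  ultimately have "f \<in> Fdr d r" using dt f(1) c by (simp add: Fdr_def)
  moreover have "Phi d f = (x, c)" by (simp add: Phi_def Psi_conv_walk eq ws(3) f(1))
  ultimately show ?thesis by blast
qed

text \<open>\<open>Psi\<close> determines the codes of the types in \<open>{1..d}\<close>, all other
  codes are empty, and codes together with root types determine the forest.\<close>

lemma Phi_inj: "inj_on (Phi d) (Fdr d r)"
proof (rule inj_onI)
  fix f f' assume F: "f \<in> Fdr d r" "f' \<in> Fdr d r" and eq: "Phi d f = Phi d f'"
  have dt: "dtype_forest d f" "dtype_forest d f'" using F by (auto simp: Fdr_def)
  have nil: "code i g = []" if "dtype_forest d g" "i \<notin> {1..d}" for i g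
  proof -
    have "filter (\<lambda>v. label v = i) (bfs_forest g) = []"
      using that unfolding dtype_forest_def filter_empty_conv by blast
    then show ?thesis using length_code[of i g] by simp
  qed
  have "code i f = code i f'" for i
  proof (cases "i \<in> {1..d}")
    case True
    then show ?thesis
      using walk_inj[of d "\<lambda>i. code i f" "\<lambda>i. code i f'" i] eq words_over_code dt
      by (simp add: Phi_def Psi_conv_walk)
  qed (use nil dt in simp)
  then show "f = f'" using eq by (intro code_unique) (auto simp: Phi_def)
qed

theorem theorem2p7:
  fixes d :: nat and r :: "nat \<Rightarrow> nat"
  assumes "d \<ge> 2" and "\<exists>i\<in>{1..d}. r i > 0"
  shows "bij_betw (Phi d) (Fdr d r) (Sdr d r \<times> Cdr d r)"
proof (rule bij_betw_imageI[OF Phi_inj])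
  show "Phi d ` Fdr d r = Sdr d r \<times> Cdr d r"
  proof (intro equalityI subsetI)
    fix y assume "y \<in> Phi d ` Fdr d r"
    then obtain f where f: "f \<in> Fdr d r" "y = Phi d f" by blast
    then have "root_types f \<in> Cdr d r" by (simp add: Fdr_def)
    then show "y \<in> Sdr d r \<times> Cdr d r" using Psi_in_Sdr[OF f(1)] f(2) by (simp add: Phi_def)
  next
    fix y assume "y \<in> Sdr d r \<times> Cdr d r"
    then obtain f where "f \<in> Fdr d r" "Phi d f = y" using Phi_surj by blast
    then show "y \<in> Phi d ` Fdr d r" by blast
  qed
qed

end
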